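(* Let $\eta,\ell\in\mathbb{R}$ with $\ell\le-3/2$ and $\eta\neq0$. Then $\varphi_{\ell,\eta}$ has countably many zeros on $\mathbb{R}$, which are all simple. Moreover, the interlacing property for the real zeros of $\varphi_{\ell,\eta}$ and $\varphi_{\ell+1,\eta}$ holds according to the following pattern: $$0<\rho_{\ell+1,\eta,1}<\rho_{\ell,\eta,1}<\rho_{\ell+1,\eta,2}<\rho_{\ell,\eta,2}<\cdots.$$
   Context: For real $\ell,\eta$, the modified regular Coulomb wave function is the entire function of $x$ $$\varphi_{\ell,\eta}(x)=\frac{1}{\Gamma(2\ell+2)}\,e^{-ix}\,{}_1F_1(\ell+1-i\eta,\,2\ell+2;\,2ix),\qquad {}_1F_1(a,b;z)=\sum_{k\ge0}\frac{(a)_k}{(b)_k}\frac{z^k}{k!},$$ when $2\ell+2$ is not a non-positive integer, where $(a)_k=\Gamma(a+k)/\Gamma(a)$ is the Pochhammer symbol; at the remaining values of $\ell$ it is defined by the limit in $\ell$. The numbers $\rho_{\ell,\eta,1}<\rho_{\ell,\eta,2}<\cdots$ denote all the positive zeros of $\varphi_{\ell,\eta}$ in increasing order. The negative zeros of $\varphi_{\ell,\eta}$ are the numbers $-\rho_{\ell,-\eta,k}$, because $\varphi_{\ell,-\eta}(x)=\varphi_{\ell,\eta}(-x)$.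
   Formalization: Simplicity is claimed for every real zero except x=0 when 2ℓ+2 is a non-positive integer: there the origin is a zero of order -2ℓ-1≥2 (e.g. a double zero at ℓ=-3/2), so the literal claim fails at that point. *)

theory Defs
  imports "HOL-Complex_Analysis.Complex_Analysis"
begin

definition hyp1F1 :: "complex \<Rightarrow> complex \<Rightarrow> complex \<Rightarrow> complex" where
  "hyp1F1 a b z = (\<Sum>k. pochhammer a k / pochhammer b k * (z ^ k / fact k))"

definition coulomb_phi_generic :: "real \<Rightarrow> real \<Rightarrow> complex \<Rightarrow> complex" where
  "coulomb_phi_generic l eta x =
     1 / Gamma (of_real (2 * l + 2)) * exp (- (\<i> * x)) *
     hyp1F1 (of_real (l + 1) - \<i> * of_real eta) (of_real (2 * l + 2)) (2 * \<i> * x)"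

text \<open>
  At the exceptional parameters the generic formula has a division by zero (a Gamma pole and
  vanishing Pochhammer symbols in the denominators), so its Isabelle value is meaningless there;
  the function is the limit over the punctured real neighbourhood of \<open>l\<close>.
\<close>

definition coulomb_phi :: "real \<Rightarrow> real \<Rightarrow> complex \<Rightarrow> complex" where
  "coulomb_phi l eta x =
     (if 2 * l + 2 \<in> \<int>\<^sub>\<le>\<^sub>0
      then Lim (at l) (\<lambda>l'. coulomb_phi_generic l' eta x)
      else coulomb_phi_generic l eta x)"

text \<open>
  The origin is included: it is a zero exactly at the exceptional parameters, where (for
  \<open>eta \<noteq> 0\<close>) its order is \<open>- 2 * l - 1\<close>, hence not simple once \<open>l \<le> - 3 / 2\<close>.
\<close>

definition coulomb_real_zeros :: "real \<Rightarrow> real \<Rightarrow> real set" where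
  "coulomb_real_zeros l eta = {x. coulomb_phi l eta (of_real x) = 0}"

text \<open>
  The index \<open>k\<close> starts at 1. As infinite sets have cardinality 0, for \<open>k \<ge> 1\<close> the
  cardinality condition entails that only finitely many zeros lie in the interval.
\<close>

definition coulomb_rho :: "real \<Rightarrow> real \<Rightarrow> nat \<Rightarrow> real" where
  "coulomb_rho l eta k =
     (THE x. 0 < x \<and> x \<in> coulomb_real_zeros l eta \<and>
        card (coulomb_real_zeros l eta \<inter> {0<..x}) = k)"

definition coulomb_rho_enumerates :: "real \<Rightarrow> real \<Rightarrow> bool" where
  "coulomb_rho_enumerates l eta \<longleftrightarrow>
     strict_mono_on {1..} (coulomb_rho l eta) \<and>
     coulomb_rho l eta ` {1..} = coulomb_real_zeros l eta \<inter> {0<..}"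

end

theory Submission
  imports Defs "HOL-Real_Asymp.Real_Asymp"
begin

text \<open>
  Put \<open>L = l + 1 \<le> -1/2\<close> and let \<open>u\<close> and \<open>v\<close> be the Coulomb functions with parameters \<open>l\<close> and \<open>l + 1\<close>.
  They solve the first-order system

    \<open>L u' = \<eta> u - 2 (\<eta>\<^sup>2 + L\<^sup>2) x v\<close>,  \<open>2 L x v' = u - 2 (L (2 L + 1) + \<eta> x) v\<close>,

  whose coefficients are real (\<open>coulomb_phi_deriv\<close>, \<open>coulomb_phi_contiguous\<close>). Away from the origin
  the system is regular, so \<open>u\<close> and \<open>v\<close> have no common zero there; at a zero \<open>x \<noteq> 0\<close> of \<open>u\<close> the first equation
  then gives \<open>u' \<noteq> 0\<close>, so the zero is simple.

  Since \<open>L < 0\<close>, on the positive axis \<open>u\<close> crosses zero in the direction of the sign of \<open>v\<close>, and \<open>v\<close> in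
  the direction of the sign of \<open>-u\<close>: the point \<open>(u, v)\<close> turns around the origin in a fixed direction whenever
  it meets an axis, and between two zeros of one function there is a zero of the other
  (\<open>zero_of_raised_between\<close>, \<open>zero_between_raised_zeros\<close>). The order is settled at the origin, where
  \<open>u(0) = 2 L (2 L + 1) v(0)\<close> with a factor that is nonnegative exactly because \<open>L \<le> -1/2\<close>: \<open>u\<close> does not
  start on the side opposite to \<open>v\<close>, and cannot vanish before \<open>v\<close> does (\<open>raised_zero_first\<close>). That there are
  infinitely many zeros follows by Sturm comparison for the second-order equation of \<open>x powr L * u\<close>
  (\<open>coulomb_zeros_unbounded\<close>).

  The exceptional parameters, where the function is defined as a limit, are absorbed by working with
  the power series with coefficients \<open>(a)\<^sub>k / \<Gamma>(b + k)\<close>. It is continuous in \<open>l\<close>, hence equals the limit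
  (\<open>coulomb_phi_eq\<close>), and it satisfies the ladder relations coefficient by coefficient for all
  parameters. Real values on the real axis are read off from the recursion for the coefficients at
  generic \<open>l\<close> and pass to the limit.
\<close>

section \<open>The regularised Kummer series\<close>

text \<open>
  The Taylor series of \<open>1 / \<Gamma>(b) * M(a, b, c x)\<close> in \<open>x\<close>, with \<open>1 / (\<Gamma>(b) (b)\<^sub>k)\<close> replaced by
  \<open>1 / \<Gamma>(b + k)\<close>: this makes every coefficient an entire function of \<open>a\<close> and \<open>b\<close>, so that the
  exceptional parameters need no separate treatment.
\<close>
definition kummer_fps :: "complex \<Rightarrow> complex \<Rightarrow> complex \<Rightarrow> complex fps" where
  "kummer_fps a b c = Abs_fps (\<lambda>k. pochhammer a k * rGamma (b + of_nat k) * c ^ k / fact k)"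

text \<open>
  With \<open>M\<close> at \<open>(a, b)\<close> and \<open>M\<^sub>1\<close> at \<open>(a + 1, b + 2)\<close>, this and the next lemma form a closed first-order
  system for the pair. Both are checked coefficientwise: after all Gamma factors are expressed by
  the one with the largest argument (\<open>R\<close> below), what remains is a polynomial identity.
\<close>
lemma kummer_fps_deriv:
  "fps_const b * fps_deriv (kummer_fps a b c) =
     fps_const (c * a) * kummer_fps a b c +
     fps_const (c\<^sup>2 * a * (b - a)) * (fps_X * kummer_fps (a + 1) (b + 2) c)"
proof (rule fps_ext)
  fix n :: nat
  show "fps_nth (fps_const b * fps_deriv (kummer_fps a b c)) n =
     fps_nth (fps_const (c * a) * kummer_fps a b c +
     fps_const (c\<^sup>2 * a * (b - a)) * (fps_X * kummer_fps (a + 1) (b + 2) c)) n"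
  proof (cases n)
    case 0
    then show ?thesis
      using rGamma_plus1[of b] by (simp add: kummer_fps_def)
  next
    case (Suc k)
    define m where "m = complex_of_nat k"
    define R where "R = rGamma (b + m + 2)"
    define P where "P = pochhammer (a + 1) k"
    have m: "m + 1 \<noteq> 0" "m + 2 \<noteq> 0" by (auto simp: m_def complex_eq_iff)
    have r: "rGamma (b + m + 1) = (b + m + 1) * R"
      using rGamma_plus1[of "b + m + 1"] by (simp add: R_def add.assoc)
    have p1: "pochhammer a (Suc k) = a * P"
      by (simp add: pochhammer_rec P_def)
    have p2: "pochhammer a (Suc (Suc k)) = a * P * (a + m + 1)"
      using pochhammer_Suc[of a "Suc k"] p1 by (simp add: add_ac m_def)
    have 1: "fps_nth (kummer_fps a b c) (Suc (Suc k)) = a * P * (a + m + 1) * R * c ^ (k + 2) / ((m + 2) * (m + 1) * fact k)"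
      unfolding kummer_fps_def fps_nth_Abs_fps p2 by (simp add: R_def m_def add_ac)
    have 2: "fps_nth (kummer_fps a b c) (Suc k) = a * P * (b + m + 1) * R * c ^ (k + 1) / ((m + 1) * fact k)"
      using r unfolding kummer_fps_def fps_nth_Abs_fps p1 by (simp add: m_def add_ac)
    have 3: "fps_nth (kummer_fps (a + 1) (b + 2) c) k = P * R * c ^ k / fact k"
      unfolding kummer_fps_def fps_nth_Abs_fps by (simp add: P_def R_def m_def add_ac)
    have "b * (m + 2) * (a * P * (a + m + 1) * R * c ^ (k + 2) / ((m + 2) * (m + 1) * fact k)) =
        c * a * (a * P * (b + m + 1) * R * c ^ (k + 1) / ((m + 1) * fact k)) +
        c\<^sup>2 * a * (b - a) * (P * R * c ^ k / fact k)"
      using m by (simp add: divide_simps power2_eq_square) (simp add: algebra_simps)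
    moreover have "fps_nth (fps_const b * fps_deriv (kummer_fps a b c)) n =
        b * (m + 2) * fps_nth (kummer_fps a b c) (Suc (Suc k))"
      by (simp add: Suc m_def add_ac)
    moreover have "fps_nth (fps_const (c * a) * kummer_fps a b c +
        fps_const (c\<^sup>2 * a * (b - a)) * (fps_X * kummer_fps (a + 1) (b + 2) c)) n =
        c * a * fps_nth (kummer_fps a b c) (Suc k) +
        c\<^sup>2 * a * (b - a) * fps_nth (kummer_fps (a + 1) (b + 2) c) k"
      by (simp add: Suc del: fps_const_mult)
    ultimately show ?thesis by (simp only: 1 2 3)
  qed
qed

lemma kummer_fps_contiguous:
  "fps_const b * (fps_X * fps_deriv (kummer_fps (a + 1) (b + 2) c)) =
     kummer_fps a b c - fps_const (b * (b + 1)) * kummer_fps (a + 1) (b + 2) c +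
     fps_const (c * (b - a)) * (fps_X * kummer_fps (a + 1) (b + 2) c)"
proof (rule fps_ext)
  fix n :: nat
  show "fps_nth (fps_const b * (fps_X * fps_deriv (kummer_fps (a + 1) (b + 2) c))) n =
     fps_nth (kummer_fps a b c - fps_const (b * (b + 1)) * kummer_fps (a + 1) (b + 2) c +
     fps_const (c * (b - a)) * (fps_X * kummer_fps (a + 1) (b + 2) c)) n"
  proof (cases n)
    case 0
    have "b * ((b + 1) * rGamma (b + 2)) = rGamma b"
      using rGamma_plus1[of b] rGamma_plus1[of "b + 1"] by (simp add: add.assoc)
    hence "rGamma b = b * (b + 1) * rGamma (b + 2)" by (simp add: mult.assoc)
    with 0 show ?thesis by (simp add: kummer_fps_def)
  next
    case (Suc k)
    define m where "m = complex_of_nat k"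
    define R where "R = rGamma (b + m + 3)"
    define P where "P = pochhammer (a + 1) k"
    have m: "m + 1 \<noteq> 0" by (auto simp: m_def complex_eq_iff)
    have r: "rGamma (b + m + 2) = (b + m + 2) * R"
      using rGamma_plus1[of "b + m + 2"] by (simp add: R_def add.assoc)
    have r': "rGamma (b + m + 1) = (b + m + 1) * (b + m + 2) * R"
      using rGamma_plus1[of "b + m + 1"] r by (simp add: add.assoc mult.assoc)
    have p1: "pochhammer a (Suc k) = a * P"
      by (simp add: pochhammer_rec P_def)
    have p2: "pochhammer (a + 1) (Suc k) = P * (a + m + 1)"
      using pochhammer_Suc[of "a + 1" k] by (simp add: add_ac m_def P_def)
    have 1: "fps_nth (kummer_fps (a + 1) (b + 2) c) (Suc k) = P * (a + m + 1) * R * c ^ (k + 1) / ((m + 1) * fact k)"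
      unfolding kummer_fps_def fps_nth_Abs_fps p2 by (simp add: R_def m_def add_ac)
    have 2: "fps_nth (kummer_fps a b c) (Suc k) = a * P * (b + m + 1) * (b + m + 2) * R * c ^ (k + 1) / ((m + 1) * fact k)"
      using r' unfolding kummer_fps_def fps_nth_Abs_fps p1 by (simp add: m_def add_ac)
    have 3: "fps_nth (kummer_fps (a + 1) (b + 2) c) k = P * (b + m + 2) * R * c ^ k / fact k"
      using r unfolding kummer_fps_def fps_nth_Abs_fps by (simp add: P_def m_def add_ac)
    have "b * ((m + 1) * (P * (a + m + 1) * R * c ^ (k + 1) / ((m + 1) * fact k))) =
        a * P * (b + m + 1) * (b + m + 2) * R * c ^ (k + 1) / ((m + 1) * fact k) -
        b * (b + 1) * (P * (a + m + 1) * R * c ^ (k + 1) / ((m + 1) * fact k)) +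
        c * (b - a) * (P * (b + m + 2) * R * c ^ k / fact k)"
      using m by (simp add: divide_simps power2_eq_square) (simp add: algebra_simps)
    moreover have "fps_nth (fps_const b * (fps_X * fps_deriv (kummer_fps (a + 1) (b + 2) c))) n =
        b * ((m + 1) * fps_nth (kummer_fps (a + 1) (b + 2) c) (Suc k))"
      by (simp add: Suc m_def add_ac)
    moreover have "fps_nth (kummer_fps a b c - fps_const (b * (b + 1)) * kummer_fps (a + 1) (b + 2) c +
        fps_const (c * (b - a)) * (fps_X * kummer_fps (a + 1) (b + 2) c)) n =
        fps_nth (kummer_fps a b c) (Suc k) - b * (b + 1) * fps_nth (kummer_fps (a + 1) (b + 2) c) (Suc k) +
        c * (b - a) * fps_nth (kummer_fps (a + 1) (b + 2) c) k"
      by (simp add: Suc del: fps_const_mult)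
    ultimately show ?thesis by (simp only: 1 2 3)
  qed
qed

lemma norm_add_of_nat_le:
  fixes a b :: complex
  assumes "norm a \<le> A" "1 \<le> Re b"
  shows "norm (a + of_nat j) \<le> (A + 1) * norm (b + of_nat j)"
proof -
  have "0 \<le> A" using assms(1) norm_ge_zero[of a] by linarith
  have "norm (a + of_nat j) \<le> A + real j"
    using norm_triangle_ineq[of a "of_nat j"] assms(1) by simp
  also have "\<dots> \<le> (A + 1) * (1 + real j)"
    using \<open>0 \<le> A\<close> by (simp add: algebra_simps)
  also have "\<dots> \<le> (A + 1) * norm (b + of_nat j)"
    using \<open>0 \<le> A\<close> assms(2) complex_Re_le_cmod[of "b + of_nat j"]
    by (intro mult_left_mono) auto
  finally show ?thesis .
qed

text \<open>
  Beyond an index \<open>N\<close> for which \<open>Re b + N \<ge> 1\<close>, consecutive coefficients have the ratio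
  \<open>(a + n) / (b + n)\<close>, which is bounded; hence geometric growth. The base of the power depends on \<open>a\<close>
  only through a bound on its norm, which makes the estimate uniform for parameters in a compact set.
\<close>
lemma kummer_coeff_bound:
  assumes "norm a \<le> A" "1 \<le> Re b + real N" "N \<le> n"
  shows "norm (pochhammer a n * rGamma (b + of_nat n)) \<le>
           norm (pochhammer a N * rGamma (b + of_nat N)) * (A + real N + 1) ^ n"
  using \<open>N \<le> n\<close>
proof (induction n rule: dec_induct)
  case base
  have "0 \<le> A" using assms(1) norm_ge_zero[of a] by linarith
  hence "1 \<le> (A + real N + 1) ^ N" by (intro one_le_power) simp
  thus ?case using mult_left_mono[of 1 "(A + real N + 1) ^ N" "norm (pochhammer a N * rGamma (b + of_nat N))"] by simp
next
  case (step n)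
  have "0 \<le> A" using assms(1) norm_ge_zero[of a] by linarith
  have nz: "norm (b + of_nat n) > 0"
    using complex_Re_le_cmod[of "b + of_nat n"] assms(2) step(1) by (intro less_le_trans[OF _ complex_Re_le_cmod]) simp
  have "norm (a + of_nat N + of_nat (n - N)) \<le> (A + real N + 1) * norm (b + of_nat N + of_nat (n - N))"
    using norm_triangle_ineq[of a "of_nat N"] assms by (intro norm_add_of_nat_le) auto
  hence le: "norm (a + of_nat n) \<le> (A + real N + 1) * norm (b + of_nat n)"
    using step(1) by (simp add: add.assoc flip: of_nat_add)
  have "rGamma (b + of_nat n) = (b + of_nat n) * rGamma (b + of_nat (Suc n))"
    using rGamma_plus1[of "b + of_nat n"] by (simp add: add_ac)
  hence "norm (pochhammer a (Suc n) * rGamma (b + of_nat (Suc n))) * norm (b + of_nat n) =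
      norm (a + of_nat n) * norm (pochhammer a n * rGamma (b + of_nat n))"
    by (simp add: pochhammer_Suc norm_mult mult_ac)
  also have "\<dots> \<le> ((A + real N + 1) * norm (b + of_nat n)) *
      (norm (pochhammer a N * rGamma (b + of_nat N)) * (A + real N + 1) ^ n)"
    using le step(3) \<open>0 \<le> A\<close> by (intro mult_mono) auto
  also have "\<dots> = norm (pochhammer a N * rGamma (b + of_nat N)) * (A + real N + 1) ^ Suc n
      * norm (b + of_nat n)"
    by (simp add: mult_ac)
  finally show ?case using nz by (rule mult_right_le_imp_le)
qed

lemma kummer_term_bound:
  assumes "norm a \<le> A" "1 \<le> Re b + real N" "N \<le> n"
  assumes B: "norm (pochhammer a N * rGamma (b + of_nat N)) \<le> B"
  shows "norm (pochhammer a n * rGamma (b + of_nat n) * c ^ n / fact n * z ^ n) \<le>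
           B * ((A + real N + 1) * norm (c * z)) ^ n / fact n"
proof -
  have "0 \<le> A" using assms(1) norm_ge_zero[of a] by linarith
  have "norm (pochhammer a n * rGamma (b + of_nat n) * c ^ n / fact n * z ^ n) =
      norm (pochhammer a n * rGamma (b + of_nat n)) * (norm (c * z) ^ n / fact n)"
    by (simp add: norm_mult norm_divide norm_power power_mult_distrib)
  also have "\<dots> \<le> norm (pochhammer a N * rGamma (b + of_nat N)) * (A + real N + 1) ^ n * (norm (c * z) ^ n / fact n)"
    by (intro mult_right_mono kummer_coeff_bound assms) auto
  also have "\<dots> \<le> B * (A + real N + 1) ^ n * (norm (c * z) ^ n / fact n)"
    using \<open>0 \<le> A\<close> by (intro mult_right_mono B) auto
  finally show ?thesis by (simp add: power_mult_distrib)
qed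

lemma summable_exp_real: "summable (\<lambda>n. B * (r :: real) ^ n / fact n)"
  using summable_mult[OF summable_exp[of r], of B] by (simp add: field_simps)

lemma summable_kummer:
  "summable (\<lambda>n. fps_nth (kummer_fps a b c) n * z ^ n)"
proof -
  obtain N :: nat where N: "1 - Re b \<le> real N" using real_arch_simple by blast
  show ?thesis
  proof (rule summable_comparison_test'[OF summable_exp_real])
    fix n assume "N \<le> n"
    with N show "norm (fps_nth (kummer_fps a b c) n * z ^ n) \<le>
        norm (pochhammer a N * rGamma (b + of_nat N)) * ((norm a + real N + 1) * norm (c * z)) ^ n / fact n"
      unfolding kummer_fps_def fps_nth_Abs_fps by (intro kummer_term_bound) auto
  qed
qed

lemma fps_conv_radius_kummer [simp]: "fps_conv_radius (kummer_fps a b c) = \<infinity>"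
  unfolding fps_conv_radius_def
  by (rule conv_radius_inftyI'') (rule summable_kummer)

section \<open>The Taylor series of the Coulomb wave function\<close>
definition coulomb_fps :: "real \<Rightarrow> real \<Rightarrow> complex fps" where
  "coulomb_fps l eta =
     fps_exp (- \<i>) *
     kummer_fps (of_real (l + 1) - \<i> * of_real eta) (of_real (2 * l + 2)) (2 * \<i>)"

lemma fps_conv_radius_coulomb [simp]: "fps_conv_radius (coulomb_fps l eta) = \<infinity>"
  using fps_conv_radius_mult[of "fps_exp (- \<i>)" "kummer_fps (of_real (l + 1) - \<i> * of_real eta) (of_real (2 * l + 2)) (2 * \<i>)"]
  by (simp add: coulomb_fps_def)

lemma eval_coulomb_fps:
  "eval_fps (coulomb_fps l eta) x = exp (- (\<i> * x)) *
     eval_fps (kummer_fps (of_real (l + 1) - \<i> * of_real eta) (of_real (2 * l + 2)) (2 * \<i>)) x"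
  by (simp add: coulomb_fps_def eval_fps_mult)

text \<open>
  The two ladder relations between the parameters \<open>l\<close> and \<open>l + 1\<close>. The factor \<open>exp (-i x)\<close> contributes
  a multiple of the series itself, which cancels the imaginary part of the coefficient coming from
  \<open>a = l + 1 - i \<eta>\<close>: the coefficients of the resulting system are real.
\<close>
lemma coulomb_fps_deriv:
  "fps_const (of_real (l + 1)) * fps_deriv (coulomb_fps l eta) =
     fps_const (of_real eta) * coulomb_fps l eta -
     fps_const (of_real (2 * (eta\<^sup>2 + (l + 1)\<^sup>2))) * (fps_X * coulomb_fps (l + 1) eta)"
proof -
  define L where "L = complex_of_real (l + 1)"
  define e where "e = complex_of_real eta"
  define E where "E = fps_exp (- \<i>)"
  define K where "K = kummer_fps (L - \<i> * e) (2 * L) (2 * \<i>)"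
  define K1 where "K1 = kummer_fps (L - \<i> * e + 1) (2 * L + 2) (2 * \<i>)"
  have U: "coulomb_fps l eta = E * K" "coulomb_fps (l + 1) eta = E * K1"
    by (simp_all add: coulomb_fps_def E_def K_def K1_def L_def e_def algebra_simps)
  have K': "fps_const (2 * L) * fps_deriv K = fps_const (2 * \<i> * (L - \<i> * e)) * K +
      fps_const (- 4 * (L\<^sup>2 + e\<^sup>2)) * (fps_X * K1)"
    using kummer_fps_deriv[of "2 * L" "L - \<i> * e" "2 * \<i>"]
    by (simp add: K_def K1_def algebra_simps power2_eq_square)
  have E': "fps_deriv E = fps_const (- \<i>) * E" by (simp add: E_def)
  have "fps_const (2 * L) * fps_deriv (E * K) =
      fps_const (2 * L) * fps_const (- \<i>) * (E * K) + E * (fps_const (2 * L) * fps_deriv K)"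
    by (simp add: E' algebra_simps)
  also have "\<dots> = (fps_const (2 * L) * fps_const (- \<i>) + fps_const (2 * \<i> * (L - \<i> * e))) * (E * K) +
      fps_const (- 4 * (L\<^sup>2 + e\<^sup>2)) * (fps_X * (E * K1))"
    unfolding K' by (simp only: algebra_simps)
  also have "fps_const (2 * L) * fps_const (- \<i>) + fps_const (2 * \<i> * (L - \<i> * e)) = fps_const (2 * e)"
    by (simp add: algebra_simps)
  finally have "fps_const (1/2) * (fps_const (2 * L) * fps_deriv (E * K)) =
      fps_const (1/2) * (fps_const (2 * e) * (E * K) + fps_const (- 4 * (L\<^sup>2 + e\<^sup>2)) * (fps_X * (E * K1)))"
    by (rule arg_cong)
  hence "fps_const L * fps_deriv (E * K) = fps_const e * (E * K) + fps_const (- 2 * (L\<^sup>2 + e\<^sup>2)) * (fps_X * (E * K1))"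
    by (simp only: distrib_left mult.assoc[symmetric] fps_const_mult) simp
  moreover have "fps_const (- 2 * (L\<^sup>2 + e\<^sup>2)) = - fps_const (of_real (2 * (eta\<^sup>2 + (l + 1)\<^sup>2)))"
    by (simp add: L_def e_def)
  ultimately show ?thesis
    unfolding U by (simp only: L_def e_def mult_minus_left diff_conv_add_uminus)
qed

lemma coulomb_fps_contiguous:
  "fps_const (of_real (2 * (l + 1))) * (fps_X * fps_deriv (coulomb_fps (l + 1) eta)) =
     coulomb_fps l eta - fps_const (of_real (2 * (l + 1) * (2 * l + 3))) * coulomb_fps (l + 1) eta
     - fps_const (of_real (2 * eta)) * (fps_X * coulomb_fps (l + 1) eta)"
proof -
  define L where "L = complex_of_real (l + 1)"
  define e where "e = complex_of_real eta"
  define E where "E = fps_exp (- \<i>)"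
  define K where "K = kummer_fps (L - \<i> * e) (2 * L) (2 * \<i>)"
  define K1 where "K1 = kummer_fps (L - \<i> * e + 1) (2 * L + 2) (2 * \<i>)"
  have U: "coulomb_fps l eta = E * K" "coulomb_fps (l + 1) eta = E * K1"
    by (simp_all add: coulomb_fps_def E_def K_def K1_def L_def e_def algebra_simps)
  have K': "fps_const (2 * L) * (fps_X * fps_deriv K1) = K - fps_const (2 * L * (2 * L + 1)) * K1 +
      fps_const (2 * \<i> * (L + \<i> * e)) * (fps_X * K1)"
    using kummer_fps_contiguous[of "2 * L" "L - \<i> * e" "2 * \<i>"]
    by (simp add: K_def K1_def algebra_simps)
  have E': "fps_deriv E = fps_const (- \<i>) * E" by (simp add: E_def)
  have "fps_const (2 * L) * (fps_X * fps_deriv (E * K1)) =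
      fps_const (2 * L) * fps_const (- \<i>) * (fps_X * (E * K1)) + E * (fps_const (2 * L) * (fps_X * fps_deriv K1))"
    by (simp add: E' algebra_simps)
  also have "\<dots> = E * K - fps_const (2 * L * (2 * L + 1)) * (E * K1) +
      (fps_const (2 * L) * fps_const (- \<i>) + fps_const (2 * \<i> * (L + \<i> * e))) * (fps_X * (E * K1))"
    unfolding K' by (simp only: algebra_simps)
  also have "fps_const (2 * L) * fps_const (- \<i>) + fps_const (2 * \<i> * (L + \<i> * e)) = fps_const (- 2 * e)"
    by (simp add: algebra_simps)
  finally show ?thesis
    unfolding U by (simp add: L_def e_def algebra_simps flip: fps_const_neg)
qed

text \<open>
  As \<open>a\<close> is not real, none of its Pochhammer symbols vanishes, and for large \<open>k\<close> the number \<open>b + k\<close> is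
  not a pole of Gamma; so even at the exceptional parameters all late coefficients of the Kummer series are nonzero.
\<close>
lemma coulomb_fps_nonzero:
  assumes "eta \<noteq> 0"
  shows "coulomb_fps l eta \<noteq> 0"
proof -
  let ?a = "of_real (l + 1) - \<i> * of_real eta" and ?b = "complex_of_real (2 * l + 2)"
  obtain k :: nat where k: "- (2 * l + 2) < real k" using reals_Archimedean2 by blast
  have "pochhammer ?a k \<noteq> 0"
  proof
    assume "pochhammer ?a k = 0"
    then obtain j where "?a = - of_nat j" by (auto simp: pochhammer_eq_0_iff)
    from arg_cong[OF this, of Im] assms show False by simp
  qed
  moreover have "rGamma (?b + of_nat k) \<noteq> 0"
  proof
    assume "rGamma (?b + of_nat k) = 0"
    then obtain m where "?b + of_nat k = of_int m" "m \<le> 0"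
      unfolding rGamma_eq_zero_iff by (elim nonpos_Ints_cases)
    from arg_cong[OF this(1), of Re] this(2) k show False by simp
  qed
  ultimately have "fps_nth (kummer_fps ?a ?b (2 * \<i>)) k \<noteq> 0"
    by (simp add: kummer_fps_def)
  hence "kummer_fps ?a ?b (2 * \<i>) \<noteq> 0" by auto
  moreover have "fps_exp (- \<i>) \<noteq> 0" using arg_cong[of "fps_exp (- \<i>)" 0 "\<lambda>f. fps_nth f 0"] by auto
  ultimately show ?thesis by (simp add: coulomb_fps_def)
qed

text \<open>
  The series converges uniformly in the parameter on \<open>[l - 1, l + 1]\<close> by the Weierstrass test. The bound
  on the coefficients only holds from an index \<open>N\<close> on, chosen for the left end of the interval.
\<close>
lemma tendsto_coulomb_param:
  "((\<lambda>l'. eval_fps (coulomb_fps l' eta) x) \<longlongrightarrow> eval_fps (coulomb_fps l eta) x) (at l)"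
proof -
  define a where "a l' = complex_of_real (l' + 1) - \<i> * of_real eta" for l'
  define b where "b l' = complex_of_real (2 * l' + 2)" for l'
  define f where "f n l' = pochhammer (a l') n * rGamma (b l' + of_nat n) * (2 * \<i>) ^ n / fact n * x ^ n" for n l'
  define I where "I = {l - 1..l + 1}"
  have cont: "continuous_on I (f n)" for n
    unfolding f_def a_def b_def pochhammer_prod by (intro continuous_intros continuous_on_compose2[OF continuous_on_rGamma]) auto
  obtain N :: nat where N: "1 - (2 * l) \<le> real N" using real_arch_simple by blast
  have "compact ((\<lambda>l'. norm (a l')) ` I)"
    unfolding I_def a_def by (intro compact_continuous_image continuous_intros) auto
  then obtain A where A: "\<And>l'. l' \<in> I \<Longrightarrow> norm (a l') \<le> A"
    by (metis (mono_tags, lifting) bounded_iff compact_imp_bounded imageI norm_ge_zero real_norm_def abs_of_nonneg)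
  have "compact ((\<lambda>l'. norm (pochhammer (a l') N * rGamma (b l' + of_nat N))) ` I)"
    unfolding I_def a_def b_def pochhammer_prod
    by (intro compact_continuous_image continuous_intros continuous_on_compose2[OF continuous_on_rGamma]) auto
  then obtain B where B: "\<And>l'. l' \<in> I \<Longrightarrow> norm (pochhammer (a l') N * rGamma (b l' + of_nat N)) \<le> B"
    by (metis (mono_tags, lifting) bounded_iff compact_imp_bounded imageI norm_ge_zero real_norm_def abs_of_nonneg)
  have "uniform_limit I (\<lambda>n l'. \<Sum>i<n. f i l') (\<lambda>l'. \<Sum>i. f i l') sequentially"
  proof (rule Weierstrass_m_test_ev[OF _ summable_exp_real])
    show "\<forall>\<^sub>F n in sequentially. \<forall>l'\<in>I. norm (f n l') \<le> B * ((A + real N + 1) * norm (2 * \<i> * x)) ^ n / fact n"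
      using eventually_ge_at_top[of N]
    proof eventually_elim
      case (elim n)
      show ?case
      proof
        fix l' assume l': "l' \<in> I"
        show "norm (f n l') \<le> B * ((A + real N + 1) * norm (2 * \<i> * x)) ^ n / fact n"
          unfolding f_def using N l' elim by (intro kummer_term_bound A B) (auto simp: b_def I_def)
      qed
    qed
  qed
  hence "continuous_on I (\<lambda>l'. \<Sum>i. f i l')"
    by (rule uniform_limit_theorem[rotated]) (auto intro!: always_eventually continuous_on_sum cont)
  hence "isCont (\<lambda>l'. \<Sum>i. f i l') l"
    by (rule continuous_on_interior) (simp add: I_def)
  hence "((\<lambda>l'. exp (- (\<i> * x)) * (\<Sum>i. f i l')) \<longlongrightarrow> exp (- (\<i> * x)) * (\<Sum>i. f i l)) (at l)"
    by (intro tendsto_mult tendsto_const) (simp add: isCont_def)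
  thus ?thesis
    unfolding eval_coulomb_fps by (simp add: eval_fps_def kummer_fps_def f_def a_def b_def)
qed

lemma coulomb_phi_generic_eq:
  assumes "2 * l + 2 \<notin> \<int>\<^sub>\<le>\<^sub>0"
  shows "coulomb_phi_generic l eta x = eval_fps (coulomb_fps l eta) x"
proof -
  let ?a = "of_real (l + 1) - \<i> * of_real eta" and ?b = "complex_of_real (2 * l + 2)"
  have b: "?b \<notin> \<int>\<^sub>\<le>\<^sub>0" using assms of_real_in_nonpos_Ints_iff by blast
  hence nz: "rGamma ?b \<noteq> 0" by (simp only: rGamma_eq_zero_iff not_False_eq_True)
  have "pochhammer ?b k \<noteq> 0" for k using b pochhammer_eq_0_imp_nonpos_Int by blast
  hence r: "rGamma (?b + of_nat k) = rGamma ?b / pochhammer ?b k" for k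
    using pochhammer_rGamma[of ?b k] by (simp add: field_simps)
  have *: "fps_nth (kummer_fps ?a ?b (2 * \<i>)) k * x ^ k =
      rGamma ?b * (pochhammer ?a k / pochhammer ?b k * ((2 * \<i> * x) ^ k / fact k))" for k
    by (simp add: kummer_fps_def r power_mult_distrib del: of_real_add of_real_mult)
  have "summable (\<lambda>k. pochhammer ?a k / pochhammer ?b k * ((2 * \<i> * x) ^ k / fact k))"
    using summable_kummer[of ?a ?b "2 * \<i>" x] nz unfolding * by (simp only: summable_cmult_iff simp_thms)
  hence "eval_fps (kummer_fps ?a ?b (2 * \<i>)) x = rGamma ?b * hyp1F1 ?a ?b (2 * \<i> * x)"
    unfolding eval_fps_def hyp1F1_def * by (rule suminf_mult)
  thus ?thesis
    by (simp add: coulomb_phi_generic_def eval_coulomb_fps rGamma_inverse_Gamma Gamma_complex_of_real divide_inverse del: of_real_add of_real_mult)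
qed

lemma eventually_not_nonpos_Int:
  "\<forall>\<^sub>F l' in at (l :: real). 2 * l' + 2 \<notin> \<int>\<^sub>\<le>\<^sub>0"
proof -
  have "closed (\<int>\<^sub>\<le>\<^sub>0 - {2 * l + 2})"
    by (rule closed_subset_Ints) auto
  hence "open (- (\<int>\<^sub>\<le>\<^sub>0 - {2 * l + 2}))" by (rule open_Compl)
  moreover have "((\<lambda>l'. 2 * l' + 2) \<longlongrightarrow> 2 * l + 2) (at l)" by (intro tendsto_intros)
  ultimately have "\<forall>\<^sub>F l' in at l. 2 * l' + 2 \<in> - (\<int>\<^sub>\<le>\<^sub>0 - {2 * l + 2})"
    by (intro topological_tendstoD) auto
  moreover have "\<forall>\<^sub>F l' in at l. l' \<noteq> l" by (simp add: eventually_at_filter)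
  ultimately show ?thesis by eventually_elim auto
qed

text \<open>
  The limit that defines the function at an exceptional parameter is the value of the same power
  series, because the exceptional parameters are isolated and the series is continuous in \<open>l\<close>.
\<close>
lemma coulomb_phi_eq: "coulomb_phi l eta x = eval_fps (coulomb_fps l eta) x"
proof (cases "2 * l + 2 \<in> \<int>\<^sub>\<le>\<^sub>0")
  case True
  have "\<forall>\<^sub>F l' in at l. eval_fps (coulomb_fps l' eta) x = coulomb_phi_generic l' eta x"
    using eventually_not_nonpos_Int[of l] by eventually_elim (simp add: coulomb_phi_generic_eq)
  hence "((\<lambda>l'. coulomb_phi_generic l' eta x) \<longlongrightarrow> eval_fps (coulomb_fps l eta) x) (at l)"
    using tendsto_coulomb_param by (rule Lim_transform_eventually[rotated])
  hence "Lim (at l) (\<lambda>l'. coulomb_phi_generic l' eta x) = eval_fps (coulomb_fps l eta) x"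
    by (intro tendsto_Lim) auto
  with True show ?thesis by (simp add: coulomb_phi_def)
qed (simp add: coulomb_phi_def coulomb_phi_generic_eq)

lemma coulomb_fps_nth_0: "fps_nth (coulomb_fps l eta) 0 = rGamma (of_real (2 * l + 2))"
  by (simp add: coulomb_fps_def kummer_fps_def)

lemma Reals_of_real_mult_cancel:
  fixes z :: complex
  assumes "of_real r * z \<in> \<real>" "r \<noteq> 0"
  shows "z \<in> \<real>"
proof -
  have "of_real (inverse r) * (of_real r * z) \<in> \<real>" by (rule Reals_mult[OF Reals_of_real assms(1)])
  also have "of_real (inverse r) * (of_real r * z) = z"
    using assms(2) by (simp flip: mult.assoc of_real_mult)
  finally show ?thesis .
qed

text \<open>
  At a generic parameter the ladder relations determine the coefficients for \<open>l\<close> and \<open>l + 1\<close>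
  recursively from the real number \<open>1 / \<Gamma>(2 l + 2)\<close>, through divisions by nonzero reals.
\<close>
lemma coulomb_fps_real_generic:
  assumes "2 * l + 2 \<notin> \<int>\<^sub>\<le>\<^sub>0"
  shows "fps_nth (coulomb_fps l eta) n \<in> \<real> \<and> fps_nth (coulomb_fps (l + 1) eta) n \<in> \<real>"
proof (induction n rule: less_induct)
  case (less n)
  let ?u = "fps_nth (coulomb_fps l eta)" and ?v = "fps_nth (coulomb_fps (l + 1) eta)"
  have nz: "2 * (l + 1) + real k \<noteq> 0" for k
  proof
    assume "2 * (l + 1) + real k = 0"
    hence "2 * l + 2 = - of_nat k" by simp
    hence "2 * l + 2 \<in> \<int>\<^sub>\<le>\<^sub>0" by (metis nonpos_Ints_of_int minus_of_nat_in_nonpos_Ints)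
    with assms show False by simp
  qed
  have u: "?u n \<in> \<real>"
  proof (cases n)
    case 0
    thus ?thesis by (simp add: coulomb_fps_nth_0 rGamma_complex_of_real del: of_real_add of_real_mult)
  next
    case (Suc k)
    have "fps_nth (fps_X * coulomb_fps (l + 1) eta) k \<in> \<real>"
      using less Suc by (auto simp: fps_X_mult_nth)
    moreover have "?u k \<in> \<real>" using less Suc by auto
    moreover have "of_real (l + 1) * (of_nat (Suc k) * ?u n) = of_real eta * ?u k -
        of_real (2 * (eta\<^sup>2 + (l + 1)\<^sup>2)) * fps_nth (fps_X * coulomb_fps (l + 1) eta) k"
      using arg_cong[OF coulomb_fps_deriv[of l eta], of "\<lambda>f. fps_nth f k"] Suc
      by (simp only: fps_mult_left_const_nth fps_sub_nth fps_deriv_nth Suc_eq_plus1)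
    ultimately have "of_real (l + 1) * (of_nat (Suc k) * ?u n) \<in> \<real>"
      by (simp only: Reals_diff Reals_mult Reals_of_real)
    moreover have "of_real (l + 1) * (of_nat (Suc k) * ?u n) = of_real ((l + 1) * real (Suc k)) * ?u n"
      by (simp add: mult.assoc)
    moreover have "(l + 1) * real (Suc k) \<noteq> 0" using nz[of 0] by simp
    ultimately show ?thesis using Reals_of_real_mult_cancel by metis
  qed
  have "fps_nth (fps_X * coulomb_fps (l + 1) eta) n \<in> \<real>"
    using less by (auto simp: fps_X_mult_nth)
  moreover have "of_real (2 * (l + 1) * (2 * (l + 1) + real (n + 1))) * ?v n =
      ?u n - of_real (2 * eta) * fps_nth (fps_X * coulomb_fps (l + 1) eta) n"
  proof -
    have X: "fps_nth (fps_X * fps_deriv (coulomb_fps (l + 1) eta)) n = of_nat n * ?v n"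
      by (cases n) simp_all
    have "of_real (2 * (l + 1)) * (of_nat n * ?v n) =
        ?u n - of_real (2 * (l + 1) * (2 * l + 3)) * ?v n
        - of_real (2 * eta) * fps_nth (fps_X * coulomb_fps (l + 1) eta) n"
      using arg_cong[OF coulomb_fps_contiguous[of l eta], of "\<lambda>f. fps_nth f n"]
      by (simp only: X fps_mult_left_const_nth fps_sub_nth)
    thus ?thesis by (simp add: algebra_simps)
  qed
  ultimately have "of_real (2 * (l + 1) * (2 * (l + 1) + real (n + 1))) * ?v n \<in> \<real>"
    using u by (simp only: Reals_diff Reals_mult Reals_of_real)
  moreover have "2 * (l + 1) * (2 * (l + 1) + real (n + 1)) \<noteq> 0"
    using nz[of 0] nz[of "n + 1"] by simp
  ultimately have "?v n \<in> \<real>" using Reals_of_real_mult_cancel by blast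
  with u show ?case by simp
qed

text \<open>
  At an exceptional parameter the recursion divides by zero and determines nothing at that index, but
  the value is a limit of real numbers.
\<close>
lemma coulomb_phi_real: "coulomb_phi l eta (of_real x) \<in> \<real>"
proof -
  have *: "eval_fps (coulomb_fps l' eta) (of_real x) \<in> \<real>" if "2 * l' + 2 \<notin> \<int>\<^sub>\<le>\<^sub>0" for l'
  proof -
    have "(\<lambda>n. fps_nth (coulomb_fps l' eta) n * of_real x ^ n) sums eval_fps (coulomb_fps l' eta) (of_real x)"
      by (rule sums_eval_fps) simp
    moreover have "fps_nth (coulomb_fps l' eta) n * of_real x ^ n \<in> \<real>" for n
      using coulomb_fps_real_generic[OF that] by (intro Reals_mult Reals_power) auto
    ultimately show ?thesis
      using closed_sequentially[OF closed_complex_Reals] unfolding sums_def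
      by (metis (no_types, lifting) sum_in_Reals)
  qed
  have "eval_fps (coulomb_fps l eta) (of_real x) \<in> \<real>"
  proof (rule Lim_in_closed_set[OF closed_complex_Reals _ _ tendsto_coulomb_param])
    show "\<forall>\<^sub>F l' in at l. eval_fps (coulomb_fps l' eta) (of_real x) \<in> \<real>"
      using eventually_not_nonpos_Int[of l] by eventually_elim (rule *)
  qed auto
  thus ?thesis by (simp add: coulomb_phi_eq)
qed

section \<open>Zeros of real functions\<close>
lemma same_sign_if_no_zero:
  fixes g :: "real \<Rightarrow> real"
  assumes "x \<le> y" "continuous_on {x..y} g" "\<And>z. x \<le> z \<Longrightarrow> z \<le> y \<Longrightarrow> g z \<noteq> 0"
  shows "0 < g x * g y"
proof (rule ccontr)
  assume "\<not> 0 < g x * g y"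
  then consider "g x \<le> 0" "0 \<le> g y" | "g y \<le> 0" "0 \<le> g x"
    unfolding zero_less_mult_iff by linarith
  thus False
  proof cases
    case 1
    from IVT'[OF this assms(1,2)] assms(3) show False by blast
  next
    case 2
    from IVT2'[OF this assms(1,2)] assms(3) show False by blast
  qed
qed

text \<open>
  If \<open>g\<close> kept its sign on the whole interval, then \<open>f\<close> would cross zero in the same direction at each
  of its zeros, which is impossible at two consecutive ones. The factor \<open>s\<close>, in practice \<open>1\<close> or \<open>-1\<close>, covers both orientations.
\<close>
lemma zero_between_zeros:
  fixes f f' g :: "real \<Rightarrow> real"
  assumes "a < b" "f a = 0" "f b = 0"
    and f': "\<And>x. a \<le> x \<Longrightarrow> x \<le> b \<Longrightarrow> (f has_real_derivative f' x) (at x)"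
    and g: "continuous_on {a..b} g"
    and sign: "\<And>x. a \<le> x \<Longrightarrow> x \<le> b \<Longrightarrow> f x = 0 \<Longrightarrow> 0 < s * f' x * g x"
  shows "\<exists>c. a < c \<and> c < b \<and> g c = 0"
proof (rule ccontr)
  assume "\<nexists>c. a < c \<and> c < b \<and> g c = 0"
  moreover have "g a \<noteq> 0" "g b \<noteq> 0" using sign[of a] sign[of b] assms(1-3) by auto
  ultimately have nz: "g x \<noteq> 0" if "a \<le> x" "x \<le> b" for x
    using that by (cases "x = a"; cases "x = b") auto
  have same: "g x * g y > 0" if "a \<le> x" "x \<le> y" "y \<le> b" for x y
    using that nz by (intro same_sign_if_no_zero continuous_on_subset[OF g]) auto
  \<comment> \<open>Normalise so that \<open>h\<close> crosses zero upwards at each zero of \<open>f\<close>. Then \<open>h\<close> is positive just to the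
      right of \<open>a\<close>, at \<open>a'\<close>, and negative just to the left of its next zero \<open>c\<close>.\<close>
  define h where "h x = s * g a * f x" for x
  have h': "(h has_real_derivative s * g a * f' x) (at x)" if "a \<le> x" "x \<le> b" for x
    unfolding h_def using f'[OF that] by (rule DERIV_cmult)
  have pos: "s * g a * f' x > 0" if "a \<le> x" "x \<le> b" "f x = 0" for x
  proof -
    have "0 < (s * f' x * g x) * (g a * g x)"
      using that by (intro mult_pos_pos[OF sign[OF that] same[of a x]]) auto
    also have "\<dots> = (s * g a * f' x) * (g x)\<^sup>2" by (simp add: power2_eq_square)
    finally show ?thesis by (simp add: zero_less_mult_iff)
  qed
  have h_0: "h x = 0 \<longleftrightarrow> f x = 0" for x using pos[of a] assms(1,2) by (auto simp: h_def)
  obtain d where d: "d > 0" "\<And>e. 0 < e \<Longrightarrow> e < d \<Longrightarrow> h a < h (a + e)"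
    using DERIV_pos_inc_right[OF h' pos, of a] assms(1,2) by auto
  define a' where "a' = a + min d (b - a) / 2"
  have a': "a < a'" "a' < b" using d assms(1) by (auto simp: a'_def min_def field_simps)
  have "h a < h (a + min d (b - a) / 2)" using d(1) assms(1) by (intro d(2)) (auto simp: min_def)
  hence "h a' > 0" using h_0[of a] assms(2) by (simp add: a'_def)
  have h_cont: "continuous_on {a..b} h"
    using h' by (intro continuous_at_imp_continuous_on ballI DERIV_isCont) auto
  have "closed ({a'..b} \<inter> h -` {0})"
    using continuous_on_subset[OF h_cont, of "{a'..b}"] a' by (intro continuous_closed_preimage) auto
  hence "compact ({a'..b} \<inter> h -` {0})" by (simp add: compact_eq_bounded_closed bounded_Int)
  moreover have "b \<in> {a'..b} \<inter> h -` {0}" using a' assms(3) h_0 by auto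
  ultimately obtain c where c: "a' \<le> c" "c \<le> b" "h c = 0"
      "\<And>x. a' \<le> x \<Longrightarrow> x \<le> b \<Longrightarrow> h x = 0 \<Longrightarrow> c \<le> x"
    using compact_attains_inf[of "{a'..b} \<inter> h -` {0}"] by (metis (mono_tags, lifting) IntD1 IntD2 IntI atLeastAtMost_iff emptyE singletonD singletonI vimageE vimageI)
  obtain d' where d': "d' > 0" "\<And>e. 0 < e \<Longrightarrow> e < d' \<Longrightarrow> h (c - e) < h c"
    using DERIV_pos_inc_left[OF h' pos, of c] c a' h_0 by auto
  have "a' < c" using c \<open>h a' > 0\<close> by (cases "a' = c") auto
  define c' where "c' = c - min d' (c - a') / 2"
  have c': "a' < c'" "c' < c" using d' \<open>a' < c\<close> by (auto simp: c'_def min_def field_simps)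
  have "h c' < 0" unfolding c'_def using d'(1) \<open>a' < c\<close> c(3) d'(2)[of "min d' (c - a') / 2"] by (auto simp: min_def)
  then obtain x where "a' \<le> x" "x \<le> c'" "h x = 0"
    using IVT2'[of h c' 0 a'] \<open>h a' > 0\<close> c' continuous_on_subset[OF h_cont, of "{a'..c'}"] a' c by auto
  with c(4)[of x] c' c(2) show False by auto
qed

text \<open>
  Sturm comparison of \<open>F'' = - q F\<close> with the solution \<open>sin ((x - a) / 2)\<close> of \<open>y'' = - y / 4\<close>, which is
  positive between its zeros \<open>a\<close> and \<open>a + 2 \<pi>\<close>. If \<open>F\<close> had no zero, the Wronskian of the two, normalised by the sign of
  \<open>F\<close>, would be nonincreasing, although it is negative at \<open>a\<close> and positive at \<open>a + 2 \<pi>\<close>.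
\<close>
lemma sturm_zero:
  fixes F G q :: "real \<Rightarrow> real"
  assumes F: "\<And>x. a \<le> x \<Longrightarrow> x \<le> a + 2 * pi \<Longrightarrow> (F has_real_derivative G x) (at x)"
    and G: "\<And>x. a \<le> x \<Longrightarrow> x \<le> a + 2 * pi \<Longrightarrow> (G has_real_derivative - q x * F x) (at x)"
    and q: "\<And>x. a \<le> x \<Longrightarrow> x \<le> a + 2 * pi \<Longrightarrow> 1 / 4 \<le> q x"
  shows "\<exists>x. a \<le> x \<and> x \<le> a + 2 * pi \<and> F x = 0"
proof (rule ccontr)
  assume nz: "\<nexists>x. a \<le> x \<and> x \<le> a + 2 * pi \<and> F x = 0"
  define b where "b = a + 2 * pi"
  have "a < b" by (simp add: b_def)
  define W where "W x = F a * (G x * sin ((x - a) / 2) - F x * cos ((x - a) / 2) / 2)" for x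
  have F_cont: "continuous_on {a..b} F"
    using F by (intro continuous_at_imp_continuous_on ballI DERIV_isCont) (auto simp: b_def)
  have same: "F a * F x > 0" if "a \<le> x" "x \<le> b" for x
    using that nz by (intro same_sign_if_no_zero continuous_on_subset[OF F_cont]) (auto simp: b_def)
  have "W b \<le> W a"
  proof (rule DERIV_nonpos_imp_nonincreasing[of a b W])
    fix x assume x: "a \<le> x" "x \<le> b"
    have "(W has_real_derivative (1 / 4 - q x) * (F a * F x) * sin ((x - a) / 2)) (at x)"
      unfolding W_def using F[of x] G[of x] x
      by (auto intro!: derivative_eq_intros simp: b_def field_simps)
    moreover have "(1 / 4 - q x) * (F a * F x) * sin ((x - a) / 2) \<le> 0"
      using q[of x] same[of x] x sin_ge_zero[of "(x - a) / 2"]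
      by (intro mult_nonpos_nonneg) (auto simp: b_def)
    ultimately show "\<exists>y. (W has_real_derivative y) (at x) \<and> y \<le> 0" by blast
  qed (use \<open>a < b\<close> in simp)
  moreover have "W a = - (F a * F a) / 2" "W b = F a * F b / 2" by (simp_all add: W_def b_def)
  ultimately show False using same[of a] same[of b] \<open>a < b\<close> by simp
qed

section \<open>Enumerating discrete sets of positive reals\<close>

text \<open>
  The enumeration by counting that underlies \<^const>\<open>coulomb_rho\<close>, for an arbitrary set.
\<close>
definition counting_enum :: "real set \<Rightarrow> nat \<Rightarrow> real" where
  "counting_enum S k = (THE x. 0 < x \<and> x \<in> S \<and> card (S \<inter> {0<..x}) = k)"

lemma counting_enum:
  assumes fin: "\<And>x. finite (S \<inter> {0<..x})" and inf: "infinite (S \<inter> {0<..})"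
  shows "strict_mono_on {1..} (counting_enum S)" "counting_enum S ` {1..} = S \<inter> {0<..}"
proof -
  define P where "P = S \<inter> {0<..}"
  define c where "c x = card (S \<inter> {0<..x})" for x
  have c_less: "c x < c y" if "y \<in> P" "x < y" for x y
  proof -
    have "y \<in> S \<inter> {0<..y}" "y \<notin> S \<inter> {0<..x}" using that by (auto simp: P_def)
    moreover have "S \<inter> {0<..x} \<subseteq> S \<inter> {0<..y}" using that by auto
    ultimately show ?thesis unfolding c_def by (intro psubset_card_mono fin) blast
  qed
  have c_mono: "c x \<le> c y" if "x \<le> y" for x y
    unfolding c_def using that by (intro card_mono fin) auto
  have c_inj: "inj_on c P"
    by (rule linorder_inj_onI') (use c_less in force)
  have c_pos: "1 \<le> c x" if "x \<in> P" for x
    using that fin[of x] by (auto simp: c_def P_def Suc_le_eq card_gt_0_iff)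
  \<comment> \<open>Counts are unbounded because \<open>c\<close> is injective on an infinite set, and no count is skipped:
      from an element of count \<open>m + 1\<close>, step down to the greatest smaller element.\<close>
  have ex: "\<exists>x\<in>P. c x = k" if "1 \<le> k" for k
  proof -
    have "infinite (c ` P)" using inf c_inj finite_imageD by (auto simp: P_def)
    then obtain n where "k \<le> n" "n \<in> c ` P"
      by (meson infinite_nat_iff_unbounded_le)
    from this(1) \<open>1 \<le> k\<close> show ?thesis
    proof (induction k rule: inc_induct)
      case base
      show ?case using \<open>n \<in> c ` P\<close> by auto
    next
      case (step m)
      then obtain y where y: "y \<in> P" "c y = Suc m" by auto
      let ?F = "S \<inter> {0<..y} - {y}"
      have F: "finite ?F" "card ?F = m"
        using y fin[of y] by (auto simp: c_def P_def card_Diff_singleton)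
      hence "?F \<noteq> {}" using step by (metis card.empty not_one_le_zero)
      with F have M: "Max ?F \<in> ?F" by (intro Max_in)
      have "S \<inter> {0<..Max ?F} = ?F"
        using M F(1) by (auto intro: Max_ge order_trans)
      with M F(2) show ?case by (intro bexI[of _ "Max ?F"]) (auto simp: c_def P_def)
    qed
  qed
  have r: "counting_enum S k \<in> P \<and> c (counting_enum S k) = k" if k: "1 \<le> k" for k
  proof -
    have "\<exists>!x. 0 < x \<and> x \<in> S \<and> card (S \<inter> {0<..x}) = k"
      using ex[OF k] c_inj by (auto simp: P_def c_def inj_on_def)
    from theI'[OF this] show ?thesis by (auto simp: counting_enum_def P_def c_def)
  qed
  show "strict_mono_on {1..} (counting_enum S)"
  proof (rule strict_mono_onI)
    fix i j :: nat assume "i \<in> {1..}" "j \<in> {1..}" "i < j"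
    thus "counting_enum S i < counting_enum S j"
      using r[of i] r[of j] c_mono[of "counting_enum S j" "counting_enum S i"] by force
  qed
  have "x = counting_enum S (c x)" if "x \<in> P" for x
    using r[OF c_pos[OF that]] that c_inj by (auto simp: inj_on_def)
  thus "counting_enum S ` {1..} = S \<inter> {0<..}"
    using r c_pos by (auto simp: P_def image_iff)
qed

text \<open>
  Two discrete sets that separate each other, of which \<open>P\<close> has the smallest element, interlace: the
  separating point beyond the \<open>k\<close>-th element bounds the next element from above.
\<close>
lemma interlacing_enumerations:
  fixes p r :: "nat \<Rightarrow> real"
  assumes p: "strict_mono_on {1..} p" "p ` {1..} = P"
    and r: "strict_mono_on {1..} r" "r ` {1..} = R"
    and disj: "P \<inter> R = {}"
    and P: "\<And>x y. x \<in> R \<Longrightarrow> y \<in> R \<Longrightarrow> x < y \<Longrightarrow> \<exists>z\<in>P. x < z \<and> z < y"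
    and R: "\<And>x y. x \<in> P \<Longrightarrow> y \<in> P \<Longrightarrow> x < y \<Longrightarrow> \<exists>z\<in>R. x < z \<and> z < y"
    and first: "\<And>y. y \<in> R \<Longrightarrow> \<exists>x\<in>P. x < y"
    and k: "1 \<le> k"
  shows "p k < r k \<and> r k < p (k + 1)"
proof -
  have next_le: "f (Suc j) \<le> x" if "strict_mono_on {1..} f" "x \<in> f ` {1..}" "f j < x" "1 \<le> j" for f :: "nat \<Rightarrow> real" and j x
  proof -
    from that(2) obtain i where i: "x = f i" "1 \<le> i" by auto
    have "j < i" using that i strict_mono_on_less[of "{1..}" f j i] by auto
    thus ?thesis using that i strict_mono_on_less_eq[of "{1..}" f "Suc j" i] by auto
  qed
  have least: "f 1 \<le> x" if "strict_mono_on {1..} f" "x \<in> f ` {1..}" for f :: "nat \<Rightarrow> real" and x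
    using that strict_mono_on_less_eq[of "{1..}" f 1] by auto
  have mem: "p j \<in> P" "r j \<in> R" if "1 \<le> j" for j using p(2) r(2) that by auto
  have p_less: "p j < p (Suc j)" and r_less: "r j < r (Suc j)" if "1 \<le> j" for j
    using that p(1) r(1) by (auto simp: strict_mono_on_def)
  show ?thesis using k
  proof (induction k rule: dec_induct)
    case base
    obtain x where "x \<in> P" "x < r 1" using first[OF mem(2)[of 1]] by auto
    hence "p 1 < r 1" using least[OF p(1), of x] p(2) by auto
    moreover obtain z where "z \<in> R" "p 1 < z" "z < p 2"
      using R[OF mem(1)[of 1] mem(1)[of 2]] p_less[of 1] by (auto simp: numeral_2_eq_2)
    hence "r 1 < p (1 + 1)" using least[OF r(1), of z] r(2) by (auto simp: numeral_2_eq_2)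
    ultimately show ?case by simp
  next
    case (step k)
    obtain x where "x \<in> P" "r k < x" "x < r (Suc k)"
      using P[OF mem(2)[of k] mem(2)[of "Suc k"]] r_less[of k] step by auto
    hence 1: "p (Suc k) < r (Suc k)" using next_le[OF p(1), of x k] p(2) step by auto
    obtain z where "z \<in> R" "p (Suc k) < z" "z < p (Suc (Suc k))"
      using R[OF mem(1)[of "Suc k"] mem(1)[of "Suc (Suc k)"]] p_less[of "Suc k"] by auto
    hence "r (Suc k) < p (Suc k + 1)" using next_le[OF r(1), of z k] r(2) step by auto
    with 1 show ?case by simp
  qed
qed

section \<open>Zeros of the Coulomb wave function\<close>

text \<open>
  Uniqueness for a holomorphic linear system: by induction, every derivative of \<open>u\<close> is a combination
  of \<open>u\<close> and \<open>v\<close> with holomorphic coefficients, so all of them vanish at a common zero.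
\<close>
lemma linear_system_zero:
  fixes u v :: "complex \<Rightarrow> complex"
  assumes S: "open S" "connected S"
    and hol: "u holomorphic_on S" "v holomorphic_on S"
      "a holomorphic_on S" "b holomorphic_on S" "c holomorphic_on S" "d holomorphic_on S"
    and u': "\<And>x. x \<in> S \<Longrightarrow> deriv u x = a x * u x + b x * v x"
    and v': "\<And>x. x \<in> S \<Longrightarrow> deriv v x = c x * u x + d x * v x"
    and z: "z \<in> S" "u z = 0" "v z = 0" and w: "w \<in> S"
  shows "u w = 0"
proof (rule holomorphic_fun_eq_0_on_connected[OF hol(1) S _ z(1) w])
  fix n
  have "\<exists>A B. A holomorphic_on S \<and> B holomorphic_on S \<and> (\<forall>x\<in>S. (deriv ^^ n) u x = A x * u x + B x * v x)"
  proof (induction n)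
    case 0
    show ?case
      by (rule exI[of _ "\<lambda>_. 1"], rule exI[of _ "\<lambda>_. 0"]) simp
  next
    case (Suc n)
    then obtain A B where AB: "A holomorphic_on S" "B holomorphic_on S"
      "\<And>x. x \<in> S \<Longrightarrow> (deriv ^^ n) u x = A x * u x + B x * v x" by blast
    have "(deriv ^^ Suc n) u x = (deriv A x + A x * a x + B x * c x) * u x + (deriv B x + A x * b x + B x * d x) * v x"
      if x: "x \<in> S" for x
    proof -
      have "((\<lambda>x. A x * u x + B x * v x) has_field_derivative
          (deriv A x * u x + deriv u x * A x + (deriv B x * v x + deriv v x * B x))) (at x)"
        by (intro DERIV_add DERIV_mult holomorphic_derivI[OF _ S(1) x] AB hol)
      hence "((deriv ^^ n) u has_field_derivative
          (deriv A x * u x + deriv u x * A x + (deriv B x * v x + deriv v x * B x))) (at x)"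
        using S(1) x by (rule has_field_derivative_transform_within_open) (simp add: AB)
      from DERIV_imp_deriv[OF this] show ?thesis
        by (simp add: u' v' x algebra_simps)
    qed
    moreover have "(\<lambda>x. deriv A x + A x * a x + B x * c x) holomorphic_on S"
      "(\<lambda>x. deriv B x + A x * b x + B x * d x) holomorphic_on S"
      using AB hol S(1) by (auto intro!: holomorphic_intros)
    ultimately show ?case by blast
  qed
  thus "(deriv ^^ n) u z = 0" using z by auto
qed

lemma has_field_derivative_coulomb_phi:
  "(coulomb_phi l eta has_field_derivative eval_fps (fps_deriv (coulomb_fps l eta)) x) (at x within A)"
  unfolding coulomb_phi_eq[abs_def] by (rule has_field_derivative_eval_fps) simp

lemma deriv_coulomb_phi: "deriv (coulomb_phi l eta) x = eval_fps (fps_deriv (coulomb_fps l eta)) x"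
  by (rule DERIV_imp_deriv[OF has_field_derivative_coulomb_phi])

lemma holomorphic_coulomb_phi [holomorphic_intros]: "coulomb_phi l eta holomorphic_on A"
  using has_field_derivative_coulomb_phi unfolding holomorphic_on_def field_differentiable_def by blast

lemma fps_conv_radius_mult_infinite:
  fixes f g :: "complex fps"
  shows
  "fps_conv_radius f = \<infinity> \<Longrightarrow> fps_conv_radius g = \<infinity> \<Longrightarrow> fps_conv_radius (f * g) = \<infinity>"
  using fps_conv_radius_mult[of f g] by simp

lemma fps_conv_radius_diff_infinite:
  fixes f g :: "complex fps"
  shows
  "fps_conv_radius f = \<infinity> \<Longrightarrow> fps_conv_radius g = \<infinity> \<Longrightarrow> fps_conv_radius (f - g) = \<infinity>"
  using fps_conv_radius_diff[of f g] by simp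

lemma fps_conv_radius_deriv_infinite:
  fixes f :: "complex fps"
  shows
  "fps_conv_radius f = \<infinity> \<Longrightarrow> fps_conv_radius (fps_deriv f) = \<infinity>"
  using fps_conv_radius_deriv[of f] by simp

lemmas infinite_conv_radius = fps_conv_radius_mult_infinite fps_conv_radius_diff_infinite
  fps_conv_radius_deriv_infinite

lemma coulomb_phi_deriv:
  "of_real (l + 1) * deriv (coulomb_phi l eta) x = of_real eta * coulomb_phi l eta x -
     of_real (2 * (eta\<^sup>2 + (l + 1)\<^sup>2)) * (x * coulomb_phi (l + 1) eta x)"
  using arg_cong[OF coulomb_fps_deriv[of l eta], of "\<lambda>f. eval_fps f x"]
  by (simp add: eval_fps_mult eval_fps_diff infinite_conv_radius deriv_coulomb_phi coulomb_phi_eq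
        del: of_real_add of_real_mult fps_const_mult)

lemma coulomb_phi_contiguous:
  "of_real (2 * (l + 1)) * (x * deriv (coulomb_phi (l + 1) eta) x) =
     coulomb_phi l eta x - of_real (2 * (l + 1) * (2 * l + 3)) * coulomb_phi (l + 1) eta x
     - of_real (2 * eta) * (x * coulomb_phi (l + 1) eta x)"
  using arg_cong[OF coulomb_fps_contiguous[of l eta], of "\<lambda>f. eval_fps f x"]
  by (simp add: eval_fps_mult eval_fps_diff infinite_conv_radius deriv_coulomb_phi coulomb_phi_eq
        del: of_real_add of_real_mult fps_const_mult)

text \<open>
  Vanishing is only required away from the origin, the domain on which the system has holomorphic
  coefficients.
\<close>
lemma coulomb_phi_not_zero:
  assumes "eta \<noteq> 0"
  shows "\<not> (\<forall>x. x \<noteq> 0 \<longrightarrow> coulomb_phi l eta x = 0)"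
proof
  assume *: "\<forall>x. x \<noteq> 0 \<longrightarrow> coulomb_phi l eta x = 0"
  have "(coulomb_phi l eta \<longlongrightarrow> coulomb_phi l eta 0) (at 0)"
    using DERIV_isCont[OF has_field_derivative_coulomb_phi] by (simp add: isCont_def)
  moreover have "(coulomb_phi l eta \<longlongrightarrow> 0) (at 0)"
    by (rule tendsto_eventually) (use * in \<open>simp add: eventually_at_filter\<close>)
  ultimately have "coulomb_phi l eta 0 = 0" using LIM_unique by blast
  with * have "eval_fps (coulomb_fps l eta) x = eval_fps 0 x" for x
    by (cases "x = 0") (auto simp: coulomb_phi_eq)
  hence "coulomb_fps l eta = 0" by (intro eval_fps_eqD) auto
  with coulomb_fps_nonzero[OF assms] show False by simp
qed

text \<open>
  For \<open>l \<noteq> -1\<close> and \<open>x \<noteq> 0\<close> the ladder relations can be solved for the two derivatives, so uniqueness applies.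
\<close>
lemma coulomb_phi_no_common_zero:
  assumes "l \<noteq> -1" "eta \<noteq> 0" "x \<noteq> 0" "coulomb_phi l eta x = 0"
  shows "coulomb_phi (l + 1) eta x \<noteq> 0"
proof
  assume 0: "coulomb_phi (l + 1) eta x = 0"
  define L where "L = complex_of_real (l + 1)"
  have "L \<noteq> 0" using assms(1) by (simp add: L_def complex_eq_iff)
  have "coulomb_phi l eta w = 0" if "w \<noteq> 0" for w
  proof (rule linear_system_zero[where u = "coulomb_phi l eta" and v = "coulomb_phi (l + 1) eta" and S = "-{0}" and z = x
      and a = "\<lambda>_. of_real eta / L" and b = "\<lambda>x. - of_real (2 * (eta\<^sup>2 + (l + 1)\<^sup>2)) * x / L"
      and c = "\<lambda>x. 1 / (2 * L * x)"
      and d = "\<lambda>x. - (of_real (2 * (l + 1) * (2 * l + 3)) + of_real (2 * eta) * x) / (2 * L * x)"])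
    show "connected (- {0 :: complex})" by (rule connected_punctured_universe) simp
    show "deriv (coulomb_phi l eta) y = of_real eta / L * coulomb_phi l eta y +
        - of_real (2 * (eta\<^sup>2 + (l + 1)\<^sup>2)) * y / L * coulomb_phi (l + 1) eta y" if "y \<in> -{0}" for y
      using coulomb_phi_deriv[of l eta y, folded L_def] \<open>L \<noteq> 0\<close>
      by (simp add: divide_simps del: of_real_add of_real_mult) (simp add: mult_ac)
    show "deriv (coulomb_phi (l + 1) eta) y = 1 / (2 * L * y) * coulomb_phi l eta y +
        - (of_real (2 * (l + 1) * (2 * l + 3)) + of_real (2 * eta) * y) / (2 * L * y) * coulomb_phi (l + 1) eta y"
      if "y \<in> -{0}" for y
    proof -
      have "of_real (2 * (l + 1)) = 2 * L" by (simp add: L_def)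
      hence "2 * L * y * deriv (coulomb_phi (l + 1) eta) y = coulomb_phi l eta y -
          (of_real (2 * (l + 1) * (2 * l + 3)) + of_real (2 * eta) * y) * coulomb_phi (l + 1) eta y"
        using coulomb_phi_contiguous[of l y eta] by (simp add: mult.assoc algebra_simps del: of_real_add of_real_mult)
      with that \<open>L \<noteq> 0\<close> show ?thesis
        by (simp add: field_simps del: of_real_add of_real_mult)
    qed
  qed (use assms 0 that \<open>L \<noteq> 0\<close> in \<open>auto intro!: holomorphic_intros\<close>)
  with coulomb_phi_not_zero[OF assms(2)] show False by blast
qed

text \<open>
  At a zero, the first ladder relation expresses the derivative as a nonzero multiple of the
  function at \<open>l + 1\<close>, which does not vanish there.
\<close>
lemma coulomb_phi_simple_zero:
  assumes "l \<noteq> -1" "eta \<noteq> 0" "x \<noteq> 0" "coulomb_phi l eta (of_real x) = 0"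
  shows "zorder (coulomb_phi l eta) (of_real x) = 1"
proof (rule zorder_zero_eqI[where S = UNIV])
  have "coulomb_phi (l + 1) eta (of_real x) \<noteq> 0"
    using assms by (intro coulomb_phi_no_common_zero) auto
  moreover have "complex_of_real (2 * (eta\<^sup>2 + (l + 1)\<^sup>2)) \<noteq> 0"
    using assms(2) unfolding of_real_eq_0_iff by (simp add: sum_power2_eq_zero_iff del: distrib_left_numeral)
  ultimately have "of_real (l + 1) * deriv (coulomb_phi l eta) (of_real x) \<noteq> 0"
    using assms(3,4) coulomb_phi_deriv[of l eta "of_real x"]
    by (simp del: of_real_add of_real_mult distrib_left_numeral)
  thus "(deriv ^^ nat 1) (coulomb_phi l eta) (of_real x) \<noteq> 0" by auto
qed (use assms(4) in \<open>auto intro!: holomorphic_intros\<close>)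

definition coulomb_real :: "real \<Rightarrow> real \<Rightarrow> real \<Rightarrow> real" where
  "coulomb_real l eta x = Re (coulomb_phi l eta (of_real x))"

lemma coulomb_phi_of_real: "coulomb_phi l eta (of_real x) = of_real (coulomb_real l eta x)"
  using coulomb_phi_real[of l eta x] by (simp add: coulomb_real_def)

lemma coulomb_real_zeros_eq: "coulomb_real_zeros l eta = {x. coulomb_real l eta x = 0}"
  by (simp add: coulomb_real_zeros_def coulomb_phi_of_real)

lemma coulomb_real_has_derivative:
  "(coulomb_real l eta has_real_derivative Re (deriv (coulomb_phi l eta) (of_real x))) (at x)"
proof -
  have "((\<lambda>x. coulomb_phi l eta (of_real x)) has_vector_derivative deriv (coulomb_phi l eta) (of_real x)) (at x)"
    unfolding deriv_coulomb_phi by (rule has_vector_derivative_real_field has_field_derivative_coulomb_phi)+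
  from bounded_linear.has_vector_derivative[OF bounded_linear_Re this] show ?thesis
    by (simp add: coulomb_real_def[abs_def] has_real_derivative_iff_has_vector_derivative)
qed

lemma continuous_on_coulomb_real: "continuous_on A (coulomb_real l eta)"
  by (intro continuous_at_imp_continuous_on ballI DERIV_isCont[OF coulomb_real_has_derivative])

lemma coulomb_real_deriv:
  assumes "L = l + 1" "L \<noteq> 0"
  shows "(coulomb_real l eta has_real_derivative
    (eta * coulomb_real l eta x - 2 * (eta\<^sup>2 + L\<^sup>2) * x * coulomb_real (l + 1) eta x) / L) (at x)"
proof -
  have "Re (of_real L * deriv (coulomb_phi l eta) (of_real x)) =
      eta * coulomb_real l eta x - 2 * (eta\<^sup>2 + L\<^sup>2) * x * coulomb_real (l + 1) eta x"
    unfolding assms(1) coulomb_phi_deriv coulomb_phi_of_real of_real_mult[symmetric] of_real_diff[symmetric] Re_complex_of_real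
    by (simp add: mult_ac)
  hence "Re (deriv (coulomb_phi l eta) (of_real x)) =
      (eta * coulomb_real l eta x - 2 * (eta\<^sup>2 + L\<^sup>2) * x * coulomb_real (l + 1) eta x) / L"
    using assms(2) by (simp add: field_simps)
  with coulomb_real_has_derivative[of l eta x] show ?thesis by simp
qed

lemma coulomb_real_contiguous:
  assumes "L = l + 1"
  shows "2 * L * x * Re (deriv (coulomb_phi (l + 1) eta) (of_real x)) =
      coulomb_real l eta x - 2 * (L * (2 * L + 1) + eta * x) * coulomb_real (l + 1) eta x"
proof -
  have "Re (of_real (2 * L) * (of_real x * deriv (coulomb_phi (l + 1) eta) (of_real x))) =
      coulomb_real l eta x - 2 * (L * (2 * L + 1) + eta * x) * coulomb_real (l + 1) eta x"
    unfolding assms(1) coulomb_phi_contiguous coulomb_phi_of_real of_real_mult[symmetric] of_real_diff[symmetric] Re_complex_of_real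
    by (simp add: algebra_simps)
  thus ?thesis by (simp add: mult.assoc)
qed

lemma coulomb_real_deriv_raised:
  assumes "L = l + 1" "L \<noteq> 0" "x \<noteq> 0"
  shows "(coulomb_real (l + 1) eta has_real_derivative
    (coulomb_real l eta x - 2 * (L * (2 * L + 1) + eta * x) * coulomb_real (l + 1) eta x) / (2 * L * x)) (at x)"
proof -
  have "2 * L * x \<noteq> 0" using assms(2,3) by simp
  with coulomb_real_contiguous[OF assms(1), of x eta] coulomb_real_has_derivative[of "l + 1" eta x]
  show ?thesis by (metis nonzero_mult_div_cancel_left)
qed

text \<open>
  For \<open>l \<le> -3/2\<close> the factor is nonnegative: this is where the full hypothesis on \<open>l\<close> enters, not just
  \<open>l < -1\<close>, and it decides which of the two functions vanishes first.
\<close>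
lemma coulomb_real_at_0: "coulomb_real l eta 0 = 2 * (l + 1) * (2 * l + 3) * coulomb_real (l + 1) eta 0"
  using coulomb_real_contiguous[of "l + 1" l 0 eta] by (simp add: algebra_simps)

lemma coulomb_real_no_common_zero:
  assumes "l \<noteq> -1" "eta \<noteq> 0" "x \<noteq> 0" "coulomb_real l eta x = 0"
  shows "coulomb_real (l + 1) eta x \<noteq> 0"
  using coulomb_phi_no_common_zero[of l eta "of_real x"] assms by (simp add: coulomb_phi_of_real)

text \<open>
  The zeros of a nonconstant entire function are discrete; a constant one does not vanish, as it is not identically zero.
\<close>
lemma finite_coulomb_zeros:
  assumes "eta \<noteq> 0"
  shows "finite {x \<in> {a..b}. coulomb_real l eta x = 0}"
proof (cases "coulomb_phi l eta constant_on UNIV")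
  case True
  then obtain c where c: "\<And>x. coulomb_phi l eta x = c" by (auto simp: constant_on_def)
  with coulomb_phi_not_zero[OF assms, of l] have "c \<noteq> 0" by auto
  hence "coulomb_real l eta x \<noteq> 0" for x
    using c[of "of_real x"] by (auto simp: coulomb_phi_of_real)
  thus ?thesis by simp
next
  case False
  hence "finite {z \<in> complex_of_real ` {a..b}. coulomb_phi l eta z = 0}"
    by (intro holomorphic_compact_finite_zeros[where S = UNIV] compact_continuous_image holomorphic_intros continuous_intros) auto
  moreover have "complex_of_real ` {x \<in> {a..b}. coulomb_real l eta x = 0} \<subseteq> {z \<in> complex_of_real ` {a..b}. coulomb_phi l eta z = 0}"
    by (auto simp: coulomb_phi_of_real)
  ultimately have "finite (complex_of_real ` {x \<in> {a..b}. coulomb_real l eta x = 0})"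
    using finite_subset by blast
  thus ?thesis by (rule finite_imageD) (simp add: inj_on_def)
qed

context
  fixes l eta L :: real
  assumes L: "L = l + 1" and neg: "L < 0" and eta: "eta \<noteq> 0"
begin

text \<open>
  Write \<open>u\<close>, \<open>v\<close> for the functions at \<open>l\<close>, \<open>l + 1\<close>. At a positive zero of \<open>u\<close> the derivative \<open>u'\<close> has the
  sign of \<open>v\<close>, and at a positive zero of \<open>v\<close> the derivative \<open>v'\<close> has the sign of \<open>-u\<close>, because \<open>L < 0\<close>.
  Hence each function vanishes between two zeros of the other.
\<close>
lemma zero_of_raised_between:
  assumes "0 < x" "x < y" "coulomb_real l eta x = 0" "coulomb_real l eta y = 0"
  shows "\<exists>z. x < z \<and> z < y \<and> coulomb_real (l + 1) eta z = 0"
proof (rule zero_between_zeros[where s = 1, OF assms(2-4) coulomb_real_deriv[OF L] continuous_on_coulomb_real])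
  fix w assume w: "x \<le> w" "w \<le> y" "coulomb_real l eta w = 0"
  have "0 < (coulomb_real (l + 1) eta w)\<^sup>2"
    using coulomb_real_no_common_zero[of l eta w] w L neg eta assms(1) by simp
  moreover have "0 < eta\<^sup>2 + L\<^sup>2" using eta by (intro add_pos_nonneg) auto
  moreover have "0 < w / (- L)" using w assms(1) neg by (intro divide_pos_pos) auto
  ultimately have "0 < 2 * (eta\<^sup>2 + L\<^sup>2) * (w / (- L)) * (coulomb_real (l + 1) eta w)\<^sup>2"
    by (intro mult_pos_pos) auto
  thus "0 < 1 * ((eta * coulomb_real l eta w - 2 * (eta\<^sup>2 + L\<^sup>2) * w * coulomb_real (l + 1) eta w) / L) * coulomb_real (l + 1) eta w"
    using w(3) by (simp add: power2_eq_square)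
qed (use L neg in auto)

lemma zero_between_raised_zeros:
  assumes "0 < x" "x < y" "coulomb_real (l + 1) eta x = 0" "coulomb_real (l + 1) eta y = 0"
  shows "\<exists>z. x < z \<and> z < y \<and> coulomb_real l eta z = 0"
proof (rule zero_between_zeros[where s = "-1", OF assms(2-4) coulomb_real_deriv_raised[OF L] continuous_on_coulomb_real])
  fix w assume w: "x \<le> w" "w \<le> y" "coulomb_real (l + 1) eta w = 0"
  have "0 < (coulomb_real l eta w)\<^sup>2"
    using coulomb_real_no_common_zero[of l eta w] w L neg eta assms(1) by auto
  moreover have "0 < 1 / (2 * (- L) * w)" using w assms(1) neg by (intro divide_pos_pos mult_pos_pos) auto
  ultimately have "0 < 1 / (2 * (- L) * w) * (coulomb_real l eta w)\<^sup>2"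
    by (rule mult_pos_pos[rotated])
  thus "0 < - 1 * ((coulomb_real l eta w - 2 * (L * (2 * L + 1) + eta * w) * coulomb_real (l + 1) eta w) / (2 * L * w)) * coulomb_real l eta w"
    using w(3) by (simp add: power2_eq_square)
qed (use L neg assms(1) in auto)

text \<open>
  As long as \<open>v\<close> has not vanished, \<open>exp (- \<eta> x / L) u\<close> moves monotonically in the direction of the sign of \<open>v\<close>;
  it starts at \<open>u(0) = 2 L (2 L + 1) v(0)\<close>, on that same side or at zero, and so cannot reach zero.
  The inequality at the origin is weak because both values may be zero at the exceptional parameters.
\<close>
lemma raised_zero_first:
  assumes "L \<le> - 1 / 2" "0 < y" "coulomb_real l eta y = 0"
  shows "\<exists>x. 0 < x \<and> x < y \<and> coulomb_real (l + 1) eta x = 0"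
proof (rule ccontr)
  let ?u = "coulomb_real l eta" and ?v = "coulomb_real (l + 1) eta"
  assume "\<nexists>x. 0 < x \<and> x < y \<and> ?v x = 0"
  moreover have "?v y \<noteq> 0" using coulomb_real_no_common_zero[of l eta y] assms L eta by auto
  ultimately have nz: "?v x \<noteq> 0" if "0 < x" "x \<le> y" for x
    using that by (cases "x = y") auto
  have same: "0 < ?v y * ?v x" if "0 < x" "x \<le> y" for x
    using same_sign_if_no_zero[OF that(2) continuous_on_coulomb_real, of "l + 1" eta] nz that
    by (simp add: mult.commute)
  have same0: "0 \<le> ?v y * ?v 0"
  proof (rule tendsto_lowerbound)
    show "((\<lambda>x. ?v y * ?v x) \<longlongrightarrow> ?v y * ?v 0) (at_right 0)"
      using DERIV_isCont[OF coulomb_real_has_derivative[of "l + 1" eta 0]]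
      by (intro tendsto_mult tendsto_const) (simp add: isCont_def filterlim_at_split)
    show "\<forall>\<^sub>F x in at_right 0. 0 \<le> ?v y * ?v x"
      using eventually_at_right_less[of 0] eventually_at_right_real[OF assms(2)]
      by eventually_elim (auto intro!: less_imp_le same)
  qed simp
  define h where "h x = ?v y * (exp (- eta * x / L) * ?u x)" for x
  have h': "(h has_real_derivative 2 * (eta\<^sup>2 + L\<^sup>2) * x / (- L) * exp (- eta * x / L) * (?v y * ?v x)) (at x)" for x
    unfolding h_def using neg
    by (auto intro!: derivative_eq_intros coulomb_real_deriv[OF L] simp: field_simps)
  have "h 0 < h y"
  proof (rule DERIV_pos_imp_increasing_open[OF assms(2)])
    fix x assume x: "0 < x" "x < y"
    have "0 < eta\<^sup>2 + L\<^sup>2" using eta by (intro add_pos_nonneg) auto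
    hence "0 < 2 * (eta\<^sup>2 + L\<^sup>2) * x / (- L) * exp (- eta * x / L) * (?v y * ?v x)"
      using x neg by (intro mult_pos_pos[OF _ same] mult_pos_pos[OF _ exp_gt_zero] divide_pos_pos) auto
    with h' show "\<exists>D. (h has_real_derivative D) (at x) \<and> 0 < D" by blast
  qed (use h' in \<open>auto intro!: continuous_at_imp_continuous_on DERIV_isCont\<close>)
  moreover have "h y = 0" by (simp add: h_def assms(3))
  moreover have "h 0 = (2 * L * (2 * L + 1)) * (?v y * ?v 0)"
    using coulomb_real_at_0[of l eta] by (simp add: h_def L algebra_simps)
  moreover have "0 \<le> (2 * L * (2 * L + 1)) * (?v y * ?v 0)"
    using assms(1) by (intro mult_nonneg_nonneg[OF _ same0] mult_nonpos_nonpos) auto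
  ultimately show False by linarith
qed

text \<open>
  Up to a constant, \<open>F = x powr (l + 1) * u\<close> is the Coulomb wave function in its usual normalisation. It satisfies
  \<open>F'' + q F = 0\<close> with \<open>q = 1 - 2 \<eta> / x - l (l + 1) / x\<^sup>2\<close>, which tends to \<open>1\<close>; so \<open>F\<close> oscillates.
\<close>
lemma coulomb_zeros_unbounded: "\<exists>x \<ge> X. coulomb_real l eta x = 0"
proof -
  let ?u = "coulomb_real l eta" and ?v = "coulomb_real (l + 1) eta"
  define q where "q x = 1 - 2 * eta / x - L * (L - 1) / x\<^sup>2" for x
  have "(q \<longlongrightarrow> 1) at_top" unfolding q_def by real_asymp
  hence "\<forall>\<^sub>F x in at_top. 1 / 4 < q x" by (rule order_tendstoD) simp
  then obtain Y where Y: "\<And>x. Y \<le> x \<Longrightarrow> 1 / 4 < q x" by (auto simp: eventually_at_top_linorder)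
  define a where "a = max 1 (max X Y)"
  have a: "1 \<le> a" "X \<le> a" "Y \<le> a" by (auto simp: a_def)
  define F where "F x = x powr L * ?u x" for x
  define G where "G x = x powr L * ((L / x + eta / L) * ?u x - 2 * (eta\<^sup>2 + L\<^sup>2) / L * (x * ?v x))" for x
  have "\<exists>x. a \<le> x \<and> x \<le> a + 2 * pi \<and> F x = 0"
  proof (rule sturm_zero)
    fix x assume x: "a \<le> x" "x \<le> a + 2 * pi"
    hence "0 < x" using a by simp
    define p where "p = x powr L"
    have p: "((\<lambda>x. x powr L) has_real_derivative L / x * p) (at x)"
      using \<open>0 < x\<close> unfolding p_def
      by (auto intro!: derivative_eq_intros simp: powr_diff)
    have "L \<noteq> 0" using neg by simp
    note u' = coulomb_real_deriv[OF L this, of eta x]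
    note v' = coulomb_real_deriv_raised[OF L \<open>L \<noteq> 0\<close> less_imp_neq[OF \<open>0 < x\<close>, symmetric], of eta]
    show "(F has_real_derivative G x) (at x)"
      unfolding F_def G_def
      by (rule DERIV_cong[OF DERIV_mult[OF p u']])
        (simp add: p_def algebra_simps add_divide_distrib diff_divide_distrib)
    define U V where "U = ?u x" and "V = ?v x"
    define g where "g x = (L / x + eta / L) * ?u x - 2 * (eta\<^sup>2 + L\<^sup>2) / L * (x * ?v x)" for x
    define U' V' where "U' = (eta * U - 2 * (eta\<^sup>2 + L\<^sup>2) * x * V) / L"
      and "V' = (U - 2 * (L * (2 * L + 1) + eta * x) * V) / (2 * L * x)"
    have c: "((\<lambda>x. L / x + eta / L) has_real_derivative - L / x\<^sup>2) (at x)"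
      using \<open>0 < x\<close> by (auto intro!: derivative_eq_intros simp: power2_eq_square)
    have g': "(g has_real_derivative - L / x\<^sup>2 * U + (L / x + eta / L) * U'
        - 2 * (eta\<^sup>2 + L\<^sup>2) / L * (V + x * V')) (at x)"
      unfolding g_def
      by (rule DERIV_cong[OF DERIV_diff[OF DERIV_mult[OF c u']
            DERIV_cmult[OF DERIV_mult[OF DERIV_ident v']]]])
        (simp add: U_def V_def U'_def V'_def mult.commute)
    \<comment> \<open>The terms with \<open>V\<close> cancel: the first-order system reduces to a scalar equation for \<open>u\<close>.\<close>
    have "- L / x\<^sup>2 * U + (L / x + eta / L) * U' - 2 * (eta\<^sup>2 + L\<^sup>2) / L * (V + x * V') +
        L / x * ((L / x + eta / L) * U - 2 * (eta\<^sup>2 + L\<^sup>2) / L * (x * V)) = - q x * U"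
      unfolding U'_def V'_def q_def using \<open>L \<noteq> 0\<close> \<open>0 < x\<close>
      by (simp add: divide_simps) (simp add: algebra_simps power2_eq_square)
    hence "L / x * p * g x + (- L / x\<^sup>2 * U + (L / x + eta / L) * U'
        - 2 * (eta\<^sup>2 + L\<^sup>2) / L * (V + x * V')) * p = - q x * (p * U)"
      unfolding g_def U_def[symmetric] V_def[symmetric] by algebra
    thus "(G has_real_derivative - q x * F x) (at x)"
      using DERIV_mult[OF p g'] unfolding F_def G_def U_def p_def g_def by simp
    show "1 / 4 \<le> q x" using Y[of x] x a by simp
  qed
  then obtain x where "a \<le> x" "F x = 0" by blast
  with a show ?thesis by (intro exI[of _ x]) (auto simp: F_def)
qed

lemma raised_zeros_unbounded: "\<exists>x \<ge> X. coulomb_real (l + 1) eta x = 0"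
proof -
  obtain x where x: "max 1 X \<le> x" "coulomb_real l eta x = 0" using coulomb_zeros_unbounded by blast
  obtain y where y: "x + 1 \<le> y" "coulomb_real l eta y = 0" using coulomb_zeros_unbounded by blast
  obtain z where "x < z" "coulomb_real (l + 1) eta z = 0"
    using zero_of_raised_between[of x y] x y by auto
  with x(1) show ?thesis by (intro exI[of _ z]) auto
qed

end

lemma infinite_if_unbounded_above:
  fixes S :: "real set"
  assumes "\<And>X. \<exists>x\<ge>X. x \<in> S"
  shows "infinite (S \<inter> {0<..})"
proof
  assume fin: "finite (S \<inter> {0<..})"
  let ?M = "Max (insert 0 (S \<inter> {0<..}))"
  obtain x where x: "?M + 1 \<le> x" "x \<in> S" using assms by blast
  have "0 \<le> ?M" using fin by (intro Max_ge) auto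
  with x have "x \<in> insert 0 (S \<inter> {0<..})" by auto
  hence "x \<le> ?M" using fin by (intro Max_ge) auto
  with x(1) show False by simp
qed

theorem theorem3p2:
  fixes l eta :: real
  assumes "l \<le> - 3 / 2" and "eta \<noteq> 0"
  shows "infinite (coulomb_real_zeros l eta) \<and> countable (coulomb_real_zeros l eta) \<and>
    (\<forall>x \<in> coulomb_real_zeros l eta.
       \<not> (x = 0 \<and> 2 * l + 2 \<in> \<int>\<^sub>\<le>\<^sub>0) \<longrightarrow> zorder (coulomb_phi l eta) (of_real x) = 1) \<and>
    coulomb_rho_enumerates l eta \<and> coulomb_rho_enumerates (l + 1) eta \<and>
    0 < coulomb_rho (l + 1) eta 1 \<and>
    (\<forall>k\<ge>1. coulomb_rho (l + 1) eta k < coulomb_rho l eta k \<and>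
            coulomb_rho l eta k < coulomb_rho (l + 1) eta (k + 1))"
proof -
  define L where "L = l + 1"
  have L: "L < 0" "L \<le> - 1 / 2" "l \<noteq> -1" using assms(1) by (auto simp: L_def)
  note facts = L_def L(1) assms(2)
  have fin: "finite (coulomb_real_zeros m eta \<inter> {0<..x})" for m x
    by (rule finite_subset[OF _ finite_coulomb_zeros[OF assms(2), of 0 x m]])
      (auto simp: coulomb_real_zeros_eq)
  have inf: "infinite (coulomb_real_zeros l eta \<inter> {0<..})" "infinite (coulomb_real_zeros (l + 1) eta \<inter> {0<..})"
    using coulomb_zeros_unbounded[OF facts] raised_zeros_unbounded[OF facts]
    by (auto intro!: infinite_if_unbounded_above simp: coulomb_real_zeros_eq)
  have rho: "coulomb_rho m eta = counting_enum (coulomb_real_zeros m eta)" for m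
    by (rule ext) (simp add: coulomb_rho_def counting_enum_def)
  note enum = counting_enum[OF fin inf(1), folded rho] counting_enum[OF fin inf(2), folded rho]
  have "coulomb_real_zeros l eta = (\<Union>n. {x \<in> {- real n..real n}. coulomb_real l eta x = 0})"
    by (auto simp: coulomb_real_zeros_eq) (meson abs_le_iff minus_le_iff real_arch_simple)
  hence "countable (coulomb_real_zeros l eta)"
    using finite_coulomb_zeros[OF assms(2)] by (simp add: countable_finite)
  moreover have "infinite (coulomb_real_zeros l eta)" using inf(1) by blast
  moreover have "zorder (coulomb_phi l eta) (of_real x) = 1"
    if "x \<in> coulomb_real_zeros l eta" "\<not> (x = 0 \<and> 2 * l + 2 \<in> \<int>\<^sub>\<le>\<^sub>0)" for x
  proof (rule coulomb_phi_simple_zero[OF L(3) assms(2)])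
    show "coulomb_phi l eta (of_real x) = 0" using that(1) by (simp add: coulomb_real_zeros_def)
    show "x \<noteq> 0"
    proof
      assume "x = 0"
      with that have "rGamma (complex_of_real (2 * l + 2)) = 0"
        by (simp add: coulomb_real_zeros_def coulomb_phi_eq eval_fps_at_0 coulomb_fps_nth_0 del: of_real_add of_real_mult)
      with that \<open>x = 0\<close> show False
        unfolding rGamma_eq_zero_iff of_real_in_nonpos_Ints_iff by simp
    qed
  qed
  moreover have "coulomb_rho_enumerates l eta" "coulomb_rho_enumerates (l + 1) eta"
    using enum by (auto simp: coulomb_rho_enumerates_def)
  moreover have "0 < coulomb_rho (l + 1) eta 1" using enum(4) by force
  moreover have "coulomb_rho (l + 1) eta k < coulomb_rho l eta k \<and>
      coulomb_rho l eta k < coulomb_rho (l + 1) eta (k + 1)" if "1 \<le> k" for k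
  proof (rule interlacing_enumerations[OF enum(3,4,1,2) _ _ _ _ that])
    show "coulomb_real_zeros (l + 1) eta \<inter> {0<..} \<inter> (coulomb_real_zeros l eta \<inter> {0<..}) = {}"
      using coulomb_real_no_common_zero[OF L(3) assms(2)] by (auto simp: coulomb_real_zeros_eq)
  next
    fix x y assume "x \<in> coulomb_real_zeros l eta \<inter> {0<..}" "y \<in> coulomb_real_zeros l eta \<inter> {0<..}" "x < y"
    thus "\<exists>z\<in>coulomb_real_zeros (l + 1) eta \<inter> {0<..}. x < z \<and> z < y"
      using zero_of_raised_between[OF facts, of x y] by (force simp: coulomb_real_zeros_eq)
  next
    fix x y assume "x \<in> coulomb_real_zeros (l + 1) eta \<inter> {0<..}" "y \<in> coulomb_real_zeros (l + 1) eta \<inter> {0<..}" "x < y"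
    thus "\<exists>z\<in>coulomb_real_zeros l eta \<inter> {0<..}. x < z \<and> z < y"
      using zero_between_raised_zeros[OF facts, of x y] by (force simp: coulomb_real_zeros_eq)
  next
    fix y assume "y \<in> coulomb_real_zeros l eta \<inter> {0<..}"
    thus "\<exists>x\<in>coulomb_real_zeros (l + 1) eta \<inter> {0<..}. x < y"
      using raised_zero_first[OF facts L(2), of y] by (force simp: coulomb_real_zeros_eq)
  qed
  ultimately show ?thesis by blast
qed

end
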